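(* Let $\alpha = \{k_1, k_2, \ldots, k_p\}$ be a partition of $n$ with $p\ge 2$ blocks, and let $\mathcal{G}(\mathcal{V}, \mathcal{E})$ be a chordal graph with $\mathcal{V} = \{1, \ldots, p\}$. If the largest maximal clique of $\mathcal{G}$ has size two (two vertices), then $$ \mathbb{S}^n_{\alpha,+}(\mathcal{E},0) \subseteq \mathcal{FW}^n_{\alpha,2}. $$
   Context: $\mathbb{S}^n$ denotes the real symmetric $n\times n$ matrices and $\mathbb{S}^n_+$ the positive semidefinite (PSD) ones. A partition of $n$ is an ordered list $\alpha=\{k_1,\ldots,k_p\}$ of positive integers with $\sum_{i=1}^p k_i=n$; throughout $p\ge 2$. An $n\times n$ matrix $X$ is correspondingly divided into blocks $X_{ij}\in\mathbb{R}^{k_i\times k_j}$. Let $E_i^\alpha\in\mathbb{R}^{k_i\times n}$ be the $i$-th block row of $I_n$ when the rows of $I_n$ are split consecutively into blocks of sizes $k_1,\ldots,k_p$, and for $i\neq j$ let $E_{ij}^\alpha=\begin{bmatrix}(E_i^\alpha)^{\mathsf T} & (E_j^\alpha)^{\mathsf T}\end{bmatrix}^{\mathsf T}\in\mathbb{R}^{(k_i+k_j)\times n}$. The set $\mathcal{FW}_{\alpha,2}^n$ of block factor-width-two matrices consists of all $Z\in\mathbb{S}^n$ of the form $Z=\sum_{i=1}^{p-1}\sum_{j=i+1}^p (E^{\alpha}_{ij})^{\mathsf T} X_{ij} E^{\alpha}_{ij}$ for some $X_{ij}\in\mathbb{S}^{k_i+k_j}_+$. Graphs are undirected, without self-loops.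 A graph is chordal if every cycle of length greater than three has a chord (an edge joining two non-consecutive vertices of the cycle). A clique is a set of pairwise adjacent vertices; it is maximal if not contained in another clique. The sparse block PSD cone is $$\mathbb{S}^n_{\alpha,+}(\mathcal{E},0)=\{X\in\mathbb{S}^n_+\mid X_{ij}=0 \text{ if } (i,j)\notin\mathcal{E},\ i\neq j\}.$$ *)

theory Defs
  imports Complex_Main "Jordan_Normal_Form.Matrix" "Graph_Theory.Pair_Digraph"
begin

section \<open>Symmetric and positive semidefinite matrices\<close>

definition sym_mats :: "nat \<Rightarrow> real mat set" where
  "sym_mats n = {A \<in> carrier_mat n n. transpose_mat A = A}"

definition psd_mats :: "nat \<Rightarrow> real mat set" where
  "psd_mats n = {A \<in> sym_mats n. \<forall>v \<in> carrier_vec n. 0 \<le> v \<bullet> (A *\<^sub>v v)}"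

section \<open>Block partitions\<close>

text \<open>Blocks are numbered from \<open>0\<close>, following the indexing of lists and matrices.\<close>

definition is_partition :: "nat \<Rightarrow> nat list \<Rightarrow> bool" where
  "is_partition n \<alpha> \<longleftrightarrow> (\<forall>k \<in> set \<alpha>. 0 < k) \<and> sum_list \<alpha> = n"

definition block_start :: "nat list \<Rightarrow> nat \<Rightarrow> nat" where
  "block_start \<alpha> i = sum_list (take i \<alpha>)"

definition block :: "nat list \<Rightarrow> 'a mat \<Rightarrow> nat \<Rightarrow> nat \<Rightarrow> 'a mat" where
  "block \<alpha> X i j =
     mat (\<alpha> ! i) (\<alpha> ! j) (\<lambda>(r, c). X $$ (block_start \<alpha> i + r, block_start \<alpha> j + c))"

definition block_row :: "nat \<Rightarrow> nat list \<Rightarrow> nat \<Rightarrow> real mat" where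
  "block_row n \<alpha> i = mat (\<alpha> ! i) n (\<lambda>(r, c). 1\<^sub>m n $$ (block_start \<alpha> i + r, c))"

definition block_row_pair :: "nat \<Rightarrow> nat list \<Rightarrow> nat \<Rightarrow> nat \<Rightarrow> real mat" where
  "block_row_pair n \<alpha> i j = block_row n \<alpha> i @\<^sub>r block_row n \<alpha> j"

section \<open>Block factor-width-two matrices\<close>

text \<open>
  Matrices of a fixed size do not form a type, so the sum is the one in the ring of
  \<open>n \<times> n\<close> matrices. Only the entries \<open>X i j\<close> with \<open>i < j < length \<alpha>\<close> are used.
\<close>

definition block_fw2 :: "nat \<Rightarrow> nat list \<Rightarrow> real mat set" where
  "block_fw2 n \<alpha> = {Z \<in> sym_mats n. \<exists>X :: nat \<Rightarrow> nat \<Rightarrow> real mat.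
     (\<forall>i j. i < j \<and> j < length \<alpha> \<longrightarrow> X i j \<in> psd_mats (\<alpha> ! i + \<alpha> ! j)) \<and>
     Z = (\<Oplus>\<^bsub>ring_mat TYPE(real) n ()\<^esub> i \<in> {0..<length \<alpha> - 1}.
           \<Oplus>\<^bsub>ring_mat TYPE(real) n ()\<^esub> j \<in> {i + 1..<length \<alpha>}.
             transpose_mat (block_row_pair n \<alpha> i j) * X i j * block_row_pair n \<alpha> i j)}"

section \<open>The sparse block PSD cone\<close>

definition sparse_block_psd :: "nat \<Rightarrow> nat list \<Rightarrow> nat rel \<Rightarrow> real mat set" where
  "sparse_block_psd n \<alpha> E = {X \<in> psd_mats n.
     \<forall>i < length \<alpha>. \<forall>j < length \<alpha>.
       (i, j) \<notin> E \<longrightarrow> i \<noteq> j \<longrightarrow> block \<alpha> X i j = 0\<^sub>m (\<alpha> ! i) (\<alpha> ! j)}"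

section \<open>Chordal graphs and cliques\<close>

text \<open>
  An undirected graph is a \<open>pair_graph\<close>: finite, loop-free, and with a symmetric arc
  relation. A cycle is the list of its arcs, so its vertices are the tails of these arcs, and
  two of its vertices are consecutive iff one of the two arcs between them occurs in the list.
\<close>

definition chordal :: "'a pair_pre_digraph \<Rightarrow> bool" where
  "chordal G \<longleftrightarrow> (\<forall>c. pre_digraph.cycle (with_proj G) c \<and> 3 < length c \<longrightarrow>
     (\<exists>u \<in> fst ` set c. \<exists>v \<in> fst ` set c.
        (u, v) \<in> parcs G \<and> (u, v) \<notin> set c \<and> (v, u) \<notin> set c))"

definition clique :: "'a pair_pre_digraph \<Rightarrow> 'a set \<Rightarrow> bool" where
  "clique G C \<longleftrightarrow> C \<subseteq> pverts G \<and> (\<forall>u \<in> C. \<forall>v \<in> C. u \<noteq> v \<longrightarrow> (u, v) \<in> parcs G)"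

definition maximal_clique :: "'a pair_pre_digraph \<Rightarrow> 'a set \<Rightarrow> bool" where
  "maximal_clique G C \<longleftrightarrow> clique G C \<and> \<not> (\<exists>D. clique G D \<and> C \<subset> D)"

end

theory Submission
  imports Defs
begin

text \<open>
  A chordal graph without triangles is a forest, so every set of blocks contains a block
  with at most one neighbour in that set. Let \<open>r\<close> be an index in such a block and \<open>x\<close> the \<open>r\<close>-th
  column of \<open>X\<close>. If \<open>X\<^sub>r\<^sub>r > 0\<close>, then \<open>x x\<^sup>T / X\<^sub>r\<^sub>r\<close> is supported on two blocks, and
  subtracting it from \<open>X\<close> keeps positive semidefiniteness and the sparsity pattern while it
  makes row and column \<open>r\<close> vanish; if \<open>X\<^sub>r\<^sub>r = 0\<close>, they vanish already. Eliminating one scalar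
  index at a time, rather than a whole block, avoids pseudo-inverses.
\<close>

section \<open>Cycles in graphs\<close>

text \<open>The first vertex is not repeated at the end. Length at least three rules out an edge run
  back and forth. Lists of vertices are easier to cut along a chord than the arc lists of
  \<open>pre_digraph.cycle\<close>.\<close>

definition cycle_verts :: "'a rel \<Rightarrow> 'a list \<Rightarrow> bool" where
  "cycle_verts E xs \<longleftrightarrow> 3 \<le> length xs \<and> distinct xs \<and>
     successively (\<lambda>u v. (u, v) \<in> E) xs \<and> (last xs, hd xs) \<in> E"

text \<open>The end vertex \<open>z\<close> is kept separate from \<open>hd xs\<close>, so that it
  stays fixed while the induction passes to the tail of \<open>xs\<close>.\<close>

lemma closed_walk_with_proj:
  assumes "xs \<noteq> []" and "successively (\<lambda>u v. (u, v) \<in> parcs G) xs" and "(last xs, z) \<in> parcs G"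
  defines "p \<equiv> zip xs (tl xs @ [z])"
  shows "pre_digraph.cas (with_proj G) (hd xs) p z"
    and "pre_digraph.awalk_verts (with_proj G) (hd xs) p = xs @ [z]"
    and "set p \<subseteq> parcs G"
proof -
  have "pre_digraph.cas (with_proj G) (hd xs) (zip xs (tl xs @ [z])) z
     \<and> pre_digraph.awalk_verts (with_proj G) (hd xs) (zip xs (tl xs @ [z])) = xs @ [z]
     \<and> set (zip xs (tl xs @ [z])) \<subseteq> parcs G"
    using assms(1-3)
  proof (induction xs rule: induct_list012)
    case (3 x y xs)
    then show ?case
      by (simp add: pre_digraph.cas.simps pre_digraph.awalk_verts.simps)
  qed (simp_all add: pre_digraph.cas.simps pre_digraph.awalk_verts.simps)
  then show "pre_digraph.cas (with_proj G) (hd xs) p z"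
    and "pre_digraph.awalk_verts (with_proj G) (hd xs) p = xs @ [z]"
    and "set p \<subseteq> parcs G"
    by (simp_all add: p_def)
qed

lemma cycle_vertsD:
  assumes "cycle_verts (parcs G) xs" and "set xs \<subseteq> pverts G"
  shows "pre_digraph.cycle (with_proj G) (zip xs (tl xs @ [hd xs]))"
proof -
  have ne: "xs \<noteq> []" and dist: "distinct xs"
    using assms(1) by (auto simp: cycle_verts_def)
  note walk = closed_walk_with_proj[of xs G "hd xs"]
  \<comment> \<open>This is the tail of the vertex sequence \<open>xs @ [hd xs]\<close> of the
    closed walk, whose distinctness \<open>pre_digraph.cycle\<close> demands.\<close>
  have "distinct (tl xs @ [hd xs])"
    using ne dist by (cases xs) auto
  moreover have "zip xs (tl xs @ [hd xs]) \<noteq> []"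
    using ne by (cases xs) auto
  moreover have "hd xs \<in> pverts G"
    using ne assms(2) by auto
  ultimately show ?thesis
    unfolding pre_digraph.cycle_def pre_digraph.awalk_def
    using walk ne assms(1) by (intro exI[of _ "hd xs"]) (simp add: cycle_verts_def)
qed

text \<open>Induction on the length: a cycle of length three is a clique with three vertices, and a
  chord of a longer cycle cuts off a shorter one.\<close>

lemma chordal_triangle_free_acyclic:
  assumes "pair_graph G" and "chordal G" and tri: "\<And>C. clique G C \<Longrightarrow> card C \<le> 2"
  shows "\<not> cycle_verts (parcs G) xs"
proof (induction xs rule: length_induct)
  case (1 xs)
  interpret pair_graph G by fact
  have sym: "(v, u) \<in> parcs G" if "(u, v) \<in> parcs G" for u v
    using that arcs_symmetric by blast
  show ?case
  proof
    assume cyc: "cycle_verts (parcs G) xs"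
    have succ: "successively (\<lambda>u v. (u, v) \<in> parcs G) xs" and dist: "distinct xs"
      and len: "3 \<le> length xs" and close: "(last xs, hd xs) \<in> parcs G"
      using cyc by (auto simp: cycle_verts_def)
    define c where "c = zip xs (tl xs @ [hd xs])"
    have ne: "xs \<noteq> []" using len by auto
    have csub: "set c \<subseteq> parcs G"
      unfolding c_def using closed_walk_with_proj(3)[OF ne succ close] .
    have lenc: "length c = length xs" and fstc: "map fst c = xs"
      using ne by (simp_all add: c_def)
    then have fsts: "fst ` set c = set xs"
      by (metis list.set_map)
    have verts: "set xs \<subseteq> pverts G"
      using csub fsts in_arcsD1 by fastforce
    \<comment> \<open>The segment from \<open>u\<close> to \<open>v\<close>, closed by the chord, is
      the shorter cycle. It has at least three vertices because \<open>u\<close>, \<open>v\<close>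
      is not an arc of the cycle (\<open>bs\<close> is nonempty), and it misses a vertex because
      \<open>v\<close>, \<open>u\<close> is not the closing arc (\<open>as\<close> or
      \<open>cs\<close> is nonempty).\<close>
    have short: False if split: "xs = as @ u # bs @ v # cs"
      and chord: "(u, v) \<in> parcs G" "(u, v) \<notin> set c" "(v, u) \<notin> set c" for as u bs v cs
    proof -
      have bs: "bs \<noteq> []"
      proof
        assume "bs = []"
        then have "(u, v) \<in> set c"
          unfolding c_def split in_set_zip
          by (intro exI[of _ "length as"], cases as) (auto simp: nth_append)
        then show False using chord by simp
      qed
      have "as \<noteq> [] \<or> cs \<noteq> []"
      proof (rule ccontr)
        assume "\<not> (as \<noteq> [] \<or> cs \<noteq> [])"
        then have "c = zip (u # bs) (bs @ [v]) @ [(v, u)]"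
          unfolding c_def split
          using zip_append[of "u # bs" "bs @ [v]" "[v]" "[u]"] by simp
        then show False using chord by simp
      qed
      moreover have "successively (\<lambda>u v. (u, v) \<in> parcs G) (u # bs @ [v])"
        using succ bs unfolding split
        by (auto simp: successively_append_iff successively_Cons hd_append)
      ultimately have "cycle_verts (parcs G) (u # bs @ [v])" "length (u # bs @ [v]) < length xs"
        using bs dist sym[OF chord(1)] unfolding split
        by (auto simp: cycle_verts_def Suc_le_eq)
      then show False using 1 by blast
    qed
    show False
    proof (cases "3 < length xs")
      case True
      have "pre_digraph.cycle (with_proj G) c"
        unfolding c_def by (rule cycle_vertsD[OF cyc verts])
      then obtain u v where uv: "u \<in> set xs" "v \<in> set xs" "(u, v) \<in> parcs G"
        "(u, v) \<notin> set c" "(v, u) \<notin> set c"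
        using \<open>chordal G\<close> True lenc fsts unfolding chordal_def by metis
      have "u \<noteq> v" using uv(3) no_loops by fastforce
      obtain as rest where s: "xs = as @ u # rest"
        using uv(1) by (meson split_list)
      \<comment> \<open>The chord may list its ends in either order, while \<open>short\<close>
        wants the earlier one first; symmetry of the arcs allows the swap.\<close>
      then consider "v \<in> set as" | "v \<in> set rest"
        using uv(2) \<open>u \<noteq> v\<close> by auto
      then show False
      proof cases
        case 1
        then obtain as' bs where "as = as' @ v # bs"
          by (meson split_list)
        then show False
          using short[of as' v bs u rest] uv sym s by simp
      next
        case 2
        then obtain bs cs where "rest = bs @ v # cs"
          by (meson split_list)
        then show False
          using short[of as u bs v cs] uv s by simp
      qed
    next
      case False
      then have "length xs = Suc (Suc (Suc 0))" using len by simp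
      then obtain a b d where xs: "xs = [a, b, d]"
        by (auto simp: length_Suc_conv)
      have "clique G {a, b, d}"
        using verts succ close sym unfolding clique_def xs by auto
      then show False using tri[of "{a, b, d}"] dist xs by simp
    qed
  qed
qed

text \<open>On a longest path inside \<open>S\<close>, every neighbour in \<open>S\<close> of the
  first vertex lies on the path, and one other than the second vertex would close a cycle. Stating
  "at most one neighbour" through \<open>w\<close> also covers isolated vertices.\<close>

lemma acyclic_ex_leaf:
  assumes "finite S" and "S \<noteq> {}" and sym: "\<And>u v. (u, v) \<in> E \<Longrightarrow> (v, u) \<in> E"
    and irrefl: "\<And>u. (u, u) \<notin> E" and acyc: "\<And>xs. \<not> cycle_verts E xs"
  shows "\<exists>v \<in> S. \<exists>w. \<forall>u \<in> S. (v, u) \<in> E \<longrightarrow> u = w"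
proof (rule ccontr)
  assume "\<not> ?thesis"
  then have two: "\<exists>u \<in> S. (v, u) \<in> E \<and> u \<noteq> w" if "v \<in> S" for v w
    using that by blast
  define path where "path xs \<longleftrightarrow> xs \<noteq> [] \<and> set xs \<subseteq> S \<and> distinct xs \<and>
    successively (\<lambda>u v. (u, v) \<in> E) xs" for xs
  obtain s where "s \<in> S" using \<open>S \<noteq> {}\<close> by auto
  then have "path [s]" by (simp add: path_def)
  moreover have "\<forall>xs. path xs \<longrightarrow> length xs < Suc (card S)"
    using \<open>finite S\<close> unfolding path_def
    by (metis card_mono distinct_card less_Suc_eq_le)
  ultimately obtain xs where xs: "path xs" and longest: "\<And>ys. path ys \<Longrightarrow> length ys \<le> length xs"
    using ex_has_greatest_nat[of path "[s]" length "Suc (card S)"] by blast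
  then obtain x ys where split: "xs = x # ys"
    unfolding path_def by (cases xs) auto
  \<comment> \<open>For \<open>ys = []\<close> the value \<open>hd ys\<close> is unspecified; this
    is harmless, since \<open>two\<close> holds for every \<open>w\<close>.\<close>
  then obtain u where u: "u \<in> S" "(x, u) \<in> E" "u \<noteq> hd ys"
    using two[of x "hd ys"] xs unfolding path_def by auto
  have "u \<in> set xs"
  proof (rule ccontr)
    assume "u \<notin> set xs"
    then have "path (u # xs)"
      using xs u sym split by (auto simp: path_def successively_Cons)
    then show False using longest by force
  qed
  moreover have "u \<noteq> x" using u irrefl by auto
  ultimately obtain as bs where ys: "ys = as @ u # bs"
    using split by (auto dest: split_list)
  then have "as \<noteq> []" using u(3) by (cases as) auto
  then have "cycle_verts E (x # as @ [u])"
    using xs u sym unfolding split ys path_def cycle_verts_def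
    by (auto simp: successively_Cons successively_append_iff Suc_le_eq)
  then show False using acyc by blast
qed

section \<open>Cliques of bounded size\<close>

text \<open>A finite graph has finitely many cliques, so each extends to a maximal one. This carries
  the bound on maximal cliques over to all cliques, triangles in particular.\<close>

lemma clique_card_le_Max:
  assumes "finite (pverts G)" and "clique G C"
  shows "card C \<le> Max (card ` {C. maximal_clique G C})"
proof -
  have sub: "{C. clique G C} \<subseteq> Pow (pverts G)"
    by (auto simp: clique_def)
  then have fin: "finite {C. clique G C}"
    using assms(1) finite_subset by blast
  then obtain D where D: "clique G D" "C \<subseteq> D" and "\<forall>D' \<in> {C. clique G C}. D \<subseteq> D' \<longrightarrow> D = D'"
    using finite_has_maximal2[OF fin, of C] assms(2) by auto
  then have "maximal_clique G D"
    by (auto simp: maximal_clique_def)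
  moreover have "finite {C. maximal_clique G C}"
    by (rule finite_subset[OF _ fin]) (auto simp: maximal_clique_def)
  moreover have "card C \<le> card D"
    using D assms(1) by (meson card_mono clique_def finite_subset)
  ultimately show ?thesis
    by (meson Max_ge finite_imageI image_eqI le_trans mem_Collect_eq)
qed

section \<open>Positive semidefinite matrices\<close>

lemma psd_mats_carrier: "A \<in> psd_mats n \<Longrightarrow> A \<in> carrier_mat n n"
  by (simp add: psd_mats_def sym_mats_def)

lemma psd_mats_sym: "A \<in> psd_mats n \<Longrightarrow> i < n \<Longrightarrow> j < n \<Longrightarrow> A $$ (i, j) = A $$ (j, i)"
  using index_transpose_mat(1)[of i A j] by (auto simp: psd_mats_def sym_mats_def)

lemma psd_mats_add: "A \<in> psd_mats n \<Longrightarrow> B \<in> psd_mats n \<Longrightarrow> A + B \<in> psd_mats n"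
  unfolding psd_mats_def sym_mats_def
  by (auto simp: transpose_add[where nr=n and nc=n] add_mult_distrib_mat_vec[where nr=n and nc=n]
      scalar_prod_add_distrib[where n=n])

lemma psd_mats_zero: "0\<^sub>m n n \<in> psd_mats n"
  by (auto simp: psd_mats_def sym_mats_def scalar_prod_def)

text \<open>The quadratic form at \<open>v\<close> is the squared norm of
  \<open>transpose_mat W *\<^sub>v v\<close>.\<close>

lemma psd_mats_gram:
  assumes "(W :: real mat) \<in> carrier_mat n m"
  shows "W * transpose_mat W \<in> psd_mats n"
proof -
  have "0 \<le> v \<bullet> (W * transpose_mat W *\<^sub>v v)" if v: "v \<in> carrier_vec n" for v
  proof -
    have t: "transpose_mat W *\<^sub>v v \<in> carrier_vec m" using assms v by simp
    have "v \<bullet> (W * transpose_mat W *\<^sub>v v) = v \<bullet> (W *\<^sub>v (transpose_mat W *\<^sub>v v))"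
      using assms v by (simp add: assoc_mult_mat_vec[of _ n m _ n])
    also have "\<dots> = (transpose_mat W *\<^sub>v v) \<bullet> (transpose_mat W *\<^sub>v v)"
      using transpose_vec_mult_scalar[OF assms t v] by simp
    also have "\<dots> \<ge> 0"
      unfolding scalar_prod_def by (rule sum_nonneg) simp
    finally show ?thesis .
  qed
  moreover have "transpose_mat (W * transpose_mat W) = W * transpose_mat W"
    using assms by (simp add: transpose_mult[of _ n m _ n])
  ultimately show ?thesis
    using assms by (auto simp: psd_mats_def sym_mats_def)
qed

section \<open>Clearing one row and column of a positive semidefinite matrix\<close>

text \<open>The right-hand side is the quadratic form at \<open>v - t e\<close>, with
  \<open>e\<close> the \<open>r\<close>-th unit vector; symmetry of \<open>A\<close> merges the two
  mixed terms. Suitable choices of \<open>t\<close> give the facts on the diagonal and on the Schur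
  complement.\<close>

lemma psd_quadratic_shift:
  assumes A: "A \<in> psd_mats n" and r: "r < n" and v: "v \<in> carrier_vec n"
  shows "0 \<le> v \<bullet> (A *\<^sub>v v) - 2 * t * (col A r \<bullet> v) + t\<^sup>2 * A $$ (r, r)"
proof -
  have AC: "A \<in> carrier_mat n n" using A by (rule psd_mats_carrier)
  have trans: "transpose_mat A = A" using A by (simp add: psd_mats_def sym_mats_def)
  let ?e = "unit_vec n r :: real vec"
  have Ae: "A *\<^sub>v ?e = col A r"
    using AC r by (intro eq_vecI) auto
  have "v \<bullet> (A *\<^sub>v ?e) = col A r \<bullet> v"
    using AC v r Ae by (simp add: comm_scalar_prod[of v n])
  moreover have "?e \<bullet> (A *\<^sub>v v) = col A r \<bullet> v"
    using transpose_vec_mult_scalar[OF AC v, of ?e] Ae trans by simp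
  moreover have "?e \<bullet> (A *\<^sub>v ?e) = A $$ (r, r)"
    unfolding Ae using AC r by simp
  moreover have "(v - t \<cdot>\<^sub>v ?e) \<bullet> (A *\<^sub>v (v - t \<cdot>\<^sub>v ?e)) =
      v \<bullet> (A *\<^sub>v v) - t * (v \<bullet> (A *\<^sub>v ?e)) - t * (?e \<bullet> (A *\<^sub>v v)) + t\<^sup>2 * (?e \<bullet> (A *\<^sub>v ?e))"
    using AC v
    by (simp add: mult_minus_distrib_mat_vec[of _ n n] mult_mat_vec[of _ n n]
        scalar_prod_minus_distrib[of _ n] minus_scalar_prod_distrib[of _ n]
        power2_eq_square algebra_simps)
  moreover have "0 \<le> (v - t \<cdot>\<^sub>v ?e) \<bullet> (A *\<^sub>v (v - t \<cdot>\<^sub>v ?e))"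
    using A v by (simp add: psd_mats_def)
  ultimately show ?thesis by simp
qed

text \<open>Without its quadratic term the shifted form is affine in \<open>t\<close>, hence
  nonnegative for all \<open>t\<close> only if its slope vanishes.\<close>

lemma psd_zero_diag:
  assumes A: "A \<in> psd_mats n" and r: "r < n" "A $$ (r, r) = 0" and i: "i < n"
  shows "A $$ (i, r) = 0"
proof (rule ccontr)
  assume nz: "A $$ (i, r) \<noteq> 0"
  let ?v = "unit_vec n i :: real vec"
  let ?c = "?v \<bullet> (A *\<^sub>v ?v)"
  have "col A r \<bullet> ?v = A $$ (i, r)"
    using psd_mats_carrier[OF A] r i by simp
  then show False
    \<comment> \<open>This \<open>t\<close> gives the shifted form the value
      \<open>?c - (?c + 1) = -1\<close>.\<close>
    using psd_quadratic_shift[OF A r(1), of ?v "(?c + 1) / (2 * A $$ (i, r))"] r(2) nz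
    by (simp add: field_simps)
qed

text \<open>The form of the new matrix at \<open>v\<close> is the minimum over \<open>t\<close> of
  the shifted form of \<open>A\<close>, attained at \<open>t = ?s / ?d\<close>.\<close>

lemma psd_schur_complement:
  assumes A: "A \<in> psd_mats n" and r: "r < n" "0 < A $$ (r, r)"
  shows "mat n n (\<lambda>(i, j). A $$ (i, j) - A $$ (i, r) * A $$ (j, r) / A $$ (r, r)) \<in> psd_mats n"
    (is "?S \<in> _")
proof -
  have AC: "A \<in> carrier_mat n n" using A by (rule psd_mats_carrier)
  have "0 \<le> v \<bullet> (?S *\<^sub>v v)" if v: "v \<in> carrier_vec n" for v
  proof -
    let ?d = "A $$ (r, r)" and ?s = "col A r \<bullet> v"
    have s: "?s = (\<Sum>i<n. A $$ (i, r) * v $ i)"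
      using AC v r by (simp add: scalar_prod_def atLeast0LessThan)
    have q: "v \<bullet> (A *\<^sub>v v) = (\<Sum>i<n. \<Sum>j<n. v $ i * A $$ (i, j) * v $ j)"
      using AC v by (simp add: scalar_prod_def atLeast0LessThan sum_distrib_left mult.assoc)
    have "v \<bullet> (?S *\<^sub>v v) =
        (\<Sum>i<n. \<Sum>j<n. v $ i * A $$ (i, j) * v $ j - A $$ (i, r) * v $ i * (A $$ (j, r) * v $ j) / ?d)"
      using v by (simp add: scalar_prod_def atLeast0LessThan sum_distrib_left algebra_simps)
    also have "\<dots> = v \<bullet> (A *\<^sub>v v) - ?s * ?s / ?d"
      by (simp add: s q sum_subtractf sum_product sum_divide_distrib)
    finally have "v \<bullet> (?S *\<^sub>v v) = v \<bullet> (A *\<^sub>v v) - ?s * ?s / ?d" .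
    moreover have "v \<bullet> (A *\<^sub>v v) - 2 * (?s / ?d) * ?s + (?s / ?d)\<^sup>2 * ?d = v \<bullet> (A *\<^sub>v v) - ?s * ?s / ?d"
      using r(2) by (simp add: power2_eq_square)
    ultimately show ?thesis
      using psd_quadratic_shift[OF A r(1) v, of "?s / ?d"] by simp
  qed
  moreover have "transpose_mat ?S = ?S"
    using psd_mats_sym[OF A] by (intro eq_matI) (auto simp: mult.commute)
  ultimately show ?thesis
    by (auto simp: psd_mats_def sym_mats_def)
qed

section \<open>Blocks\<close>

lemma block_start_Suc: "i < length \<alpha> \<Longrightarrow> block_start \<alpha> (Suc i) = block_start \<alpha> i + \<alpha> ! i"
  by (simp add: block_start_def take_Suc_conv_app_nth)

lemma block_start_mono: "i \<le> j \<Longrightarrow> block_start \<alpha> i \<le> block_start \<alpha> j"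
  using append_take_drop_id[of i "take j \<alpha>"]
  by (metis block_start_def le_add1 min.absorb1 sum_list_append take_take)

lemma block_end_le:
  "i < length \<alpha> \<Longrightarrow> i < j \<Longrightarrow> block_start \<alpha> i + \<alpha> ! i \<le> block_start \<alpha> j"
  using block_start_mono[of "Suc i" j \<alpha>] by (simp add: block_start_Suc)

lemma block_end_le_total:
  "is_partition n \<alpha> \<Longrightarrow> i < length \<alpha> \<Longrightarrow> block_start \<alpha> i + \<alpha> ! i \<le> n"
  using block_end_le[of i \<alpha> "length \<alpha>"] by (simp add: is_partition_def block_start_def)

section \<open>From blocks to scalar indices\<close>

definition block_of :: "nat list \<Rightarrow> nat \<Rightarrow> nat" where
  "block_of \<alpha> a = (LEAST i. a < block_start \<alpha> (Suc i))"

lemma block_of: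
  assumes "is_partition n \<alpha>" and "a < n"
  shows "block_of \<alpha> a < length \<alpha>" and "block_start \<alpha> (block_of \<alpha> a) \<le> a"
    and "a < block_start \<alpha> (block_of \<alpha> a) + \<alpha> ! block_of \<alpha> a"
proof -
  have "\<alpha> \<noteq> []"
    using assms by (auto simp: is_partition_def)
  then have "Suc (length \<alpha> - 1) = length \<alpha>" by simp
  \<comment> \<open>The last block ends at \<open>n\<close>, so the set whose least element is taken
    is nonempty.\<close>
  then have total: "a < block_start \<alpha> (Suc (length \<alpha> - 1))"
    using assms by (simp only: is_partition_def block_start_def take_all order_refl)
  then have "block_of \<alpha> a \<le> length \<alpha> - 1"
    unfolding block_of_def by (intro Least_le)
  then show len: "block_of \<alpha> a < length \<alpha>"
    using \<open>\<alpha> \<noteq> []\<close> by (cases \<alpha>) auto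
  have "a < block_start \<alpha> (Suc (block_of \<alpha> a))"
    unfolding block_of_def using total by (rule LeastI)
  then show "a < block_start \<alpha> (block_of \<alpha> a) + \<alpha> ! block_of \<alpha> a"
    using len by (simp add: block_start_Suc)
  show "block_start \<alpha> (block_of \<alpha> a) \<le> a"
  proof (cases "block_of \<alpha> a")
    case 0
    then show ?thesis by (simp add: block_start_def)
  next
    case (Suc i)
    \<comment> \<open>Block \<open>Suc i\<close> starts where block \<open>i\<close> ends, and by
      minimality that end is not beyond \<open>a\<close>.\<close>
    then have "\<not> a < block_start \<alpha> (Suc i)"
      using not_less_Least[of i "\<lambda>i. a < block_start \<alpha> (Suc i)"] by (simp add: block_of_def)
    then show ?thesis using Suc by simp
  qed
qed

text \<open>Turns the vanishing of blocks into a pattern of scalar entries, the form suited to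
  removing one scalar index at a time.\<close>

lemma sparse_block_psdD:
  assumes "is_partition n \<alpha>" and "X \<in> sparse_block_psd n \<alpha> E" and "a < n" "b < n"
    and "X $$ (a, b) \<noteq> 0" and "block_of \<alpha> a \<noteq> block_of \<alpha> b"
  shows "(block_of \<alpha> a, block_of \<alpha> b) \<in> E"
proof (rule ccontr)
  let ?i = "block_of \<alpha> a" and ?j = "block_of \<alpha> b"
  note a = block_of[OF assms(1) \<open>a < n\<close>] and b = block_of[OF assms(1) \<open>b < n\<close>]
  assume "(?i, ?j) \<notin> E"
  then have "block \<alpha> X ?i ?j = 0\<^sub>m (\<alpha> ! ?i) (\<alpha> ! ?j)"
    using assms a b by (auto simp: sparse_block_psd_def)
  then have "block \<alpha> X ?i ?j $$ (a - block_start \<alpha> ?i, b - block_start \<alpha> ?j) = 0"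
    using a b by simp
  then show False
    using a b assms(5) by (simp add: block_def)
qed

section \<open>Block factor-width-two matrices\<close>

lemma block_row_pair_carrier: "block_row_pair n \<alpha> i j \<in> carrier_mat (\<alpha> ! i + \<alpha> ! j) n"
  unfolding block_row_pair_def block_row_def by (rule carrier_append_rows) auto

lemma block_row_pair_index:
  assumes "is_partition n \<alpha>" and "i < length \<alpha>" "j < length \<alpha>" and "k < \<alpha> ! i + \<alpha> ! j" "c < n"
  shows "block_row_pair n \<alpha> i j $$ (k, c) =
    (if (if k < \<alpha> ! i then block_start \<alpha> i + k else block_start \<alpha> j + (k - \<alpha> ! i)) = c then 1 else 0)"
  using assms block_end_le_total[OF assms(1,2)] block_end_le_total[OF assms(1,3)]
  by (simp add: block_row_pair_def block_row_def append_rows_def)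

text \<open>\<open>?P\<close> picks out the rows in blocks \<open>i\<close> and \<open>j\<close>,
  and its transpose puts them back. Hence \<open>transpose_mat ?P * ?P\<close> is the coordinate
  projection onto these blocks and fixes every \<open>U\<close> whose nonzero rows lie
  there.\<close>

lemma block_row_pair_restore:
  assumes part: "is_partition n \<alpha>" and ij: "i < j" "j < length \<alpha>" and U: "U \<in> carrier_mat n m"
    and supp: "\<And>a c. a < n \<Longrightarrow> c < m \<Longrightarrow> U $$ (a, c) \<noteq> 0 \<Longrightarrow> block_of \<alpha> a = i \<or> block_of \<alpha> a = j"
  shows "transpose_mat (block_row_pair n \<alpha> i j) * (block_row_pair n \<alpha> i j * U) = U"
    (is "transpose_mat ?P * (?P * U) = U")
proof (rule eq_matI)
  let ?k = "\<alpha> ! i + \<alpha> ! j"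
  define \<sigma> where "\<sigma> k = (if k < \<alpha> ! i then block_start \<alpha> i + k else block_start \<alpha> j + (k - \<alpha> ! i))" for k
  have P: "?P \<in> carrier_mat ?k n" by (rule block_row_pair_carrier)
  have il: "i < length \<alpha>" using ij by simp
  have idx: "?P $$ (k, c) = (if \<sigma> k = c then 1 else 0)" if "k < ?k" "c < n" for k c
    using block_row_pair_index[OF part il ij(2) that] by (simp add: \<sigma>_def)
  have \<sigma>n: "\<sigma> k < n" if "k < ?k" for k
    using that block_end_le_total[OF part il] block_end_le_total[OF part ij(2)] by (auto simp: \<sigma>_def)
  \<comment> \<open>Block \<open>i\<close> ends before block \<open>j\<close> starts, so no scalar
    index is selected twice.\<close>
  have inj: "inj_on \<sigma> {0..<?k}"
    using block_end_le[OF il ij(1)] by (auto simp: inj_on_def \<sigma>_def split: if_splits)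
  show "dim_row (transpose_mat ?P * (?P * U)) = dim_row U"
    and "dim_col (transpose_mat ?P * (?P * U)) = dim_col U" using P U by auto
  fix a c assume "a < dim_row U" "c < dim_col U"
  then have a: "a < n" and c: "c < m" using U by auto
  define V where "V = ?P * U"
  have V: "V \<in> carrier_mat ?k m" using P U by (simp add: V_def)
  have V_index: "V $$ (k, c) = U $$ (\<sigma> k, c)" if k: "k < ?k" for k
  proof -
    have "V $$ (k, c) = (\<Sum>b = 0..<n. ?P $$ (k, b) * U $$ (b, c))"
      using P U k c by (simp add: V_def scalar_prod_def)
    also have "\<dots> = (\<Sum>b = 0..<n. if \<sigma> k = b then U $$ (b, c) else 0)"
      using k by (intro sum.cong) (auto simp: idx)
    also have "\<dots> = U $$ (\<sigma> k, c)" using \<sigma>n[OF k] by simp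
    finally show ?thesis .
  qed
  have "(transpose_mat ?P * V) $$ (a, c) = (\<Sum>k = 0..<?k. ?P $$ (k, a) * V $$ (k, c))"
    using P V a c by (simp add: scalar_prod_def)
  also have "\<dots> = (\<Sum>k = 0..<?k. if \<sigma> k = a then U $$ (a, c) else 0)"
    using a by (intro sum.cong) (auto simp: idx V_index)
  \<comment> \<open>By injectivity at most one \<open>k\<close> contributes. If none does,
    \<open>a\<close> lies outside both blocks and the entry of \<open>U\<close> is zero.\<close>
  also have "\<dots> = U $$ (a, c)"
  proof (cases "\<exists>k < ?k. \<sigma> k = a")
    case True
    then obtain k where k: "k < ?k" "\<sigma> k = a" by auto
    have "\<sigma> k' = a \<longleftrightarrow> k' = k" if "k' \<in> {0..<?k}" for k'
      using inj_on_eq_iff[OF inj that, of k] k by simp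
    then have "(\<Sum>k = 0..<?k. if \<sigma> k = a then U $$ (a, c) else 0) =
        (\<Sum>k' = 0..<?k. if k' = k then U $$ (a, c) else 0)"
      by (intro sum.cong if_cong refl)
    then show ?thesis using k by simp
  next
    case False
    have "block_of \<alpha> a \<noteq> i"
    proof
      assume "block_of \<alpha> a = i"
      then have "\<sigma> (a - block_start \<alpha> i) = a" "a - block_start \<alpha> i < ?k"
        using block_of[OF part a] by (auto simp: \<sigma>_def)
      then show False using False by blast
    qed
    moreover have "block_of \<alpha> a \<noteq> j"
    proof
      assume "block_of \<alpha> a = j"
      then have "\<sigma> (\<alpha> ! i + (a - block_start \<alpha> j)) = a" "\<alpha> ! i + (a - block_start \<alpha> j) < ?k"
        using block_of[OF part a] by (auto simp: \<sigma>_def)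
      then show False using False by blast
    qed
    ultimately have "U $$ (a, c) = 0" using supp a c by blast
    then show ?thesis by (simp cong: if_cong)
  qed
  finally show "(transpose_mat ?P * (?P * U)) $$ (a, c) = U $$ (a, c)"
    by (simp only: V_def)
qed

section \<open>The double sum over pairs of blocks, and members of the cone\<close>

definition block_fw2_sum :: "nat \<Rightarrow> nat list \<Rightarrow> (nat \<Rightarrow> nat \<Rightarrow> real mat) \<Rightarrow> real mat" where
  "block_fw2_sum n \<alpha> X = (\<Oplus>\<^bsub>ring_mat TYPE(real) n ()\<^esub> i \<in> {0..<length \<alpha> - 1}.
     \<Oplus>\<^bsub>ring_mat TYPE(real) n ()\<^esub> j \<in> {i + 1..<length \<alpha>}.
       transpose_mat (block_row_pair n \<alpha> i j) * X i j * block_row_pair n \<alpha> i j)"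

lemma block_fw2_alt:
  "block_fw2 n \<alpha> = {Z \<in> sym_mats n. \<exists>X. (\<forall>i j. i < j \<and> j < length \<alpha> \<longrightarrow>
     X i j \<in> psd_mats (\<alpha> ! i + \<alpha> ! j)) \<and> Z = block_fw2_sum n \<alpha> X}"
  by (simp add: block_fw2_def block_fw2_sum_def)

lemma congruence_carrier:
  "X \<in> carrier_mat (\<alpha> ! i + \<alpha> ! j) (\<alpha> ! i + \<alpha> ! j) \<Longrightarrow>
    transpose_mat (block_row_pair n \<alpha> i j) * X * block_row_pair n \<alpha> i j \<in> carrier_mat n n"
  using block_row_pair_carrier[of n \<alpha> i j] by (intro mult_carrier_mat) auto

text \<open>Congruence is additive in its middle factor, and both finite sums distribute over
  addition. The carrier conditions keep every summand inside the matrix ring.\<close>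

lemma block_fw2_sum_add:
  assumes X: "\<And>i j. i < j \<Longrightarrow> j < length \<alpha> \<Longrightarrow> X i j \<in> carrier_mat (\<alpha> ! i + \<alpha> ! j) (\<alpha> ! i + \<alpha> ! j)"
    and Y: "\<And>i j. i < j \<Longrightarrow> j < length \<alpha> \<Longrightarrow> Y i j \<in> carrier_mat (\<alpha> ! i + \<alpha> ! j) (\<alpha> ! i + \<alpha> ! j)"
  shows "block_fw2_sum n \<alpha> (\<lambda>i j. X i j + Y i j) = block_fw2_sum n \<alpha> X + block_fw2_sum n \<alpha> Y"
proof -
  let ?R = "ring_mat TYPE(real) n ()"
  interpret R: ring ?R by (rule ring_mat)
  let ?P = "block_row_pair n \<alpha>"
  define t where "t Z i j = transpose_mat (?P i j) * Z i j * ?P i j" for Z i j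
  let ?s = "\<lambda>Z i. \<Oplus>\<^bsub>?R\<^esub> j \<in> {i + 1..<length \<alpha>}. t Z i j"
  have tX: "t X i \<in> {i + 1..<length \<alpha>} \<rightarrow> carrier ?R" and tY: "t Y i \<in> {i + 1..<length \<alpha>} \<rightarrow> carrier ?R"
    for i
    using X Y by (auto simp: t_def ring_mat_simps intro!: congruence_carrier)
  have dist: "t (\<lambda>i j. X i j + Y i j) i j = t X i j \<oplus>\<^bsub>?R\<^esub> t Y i j"
    if "i < j" "j < length \<alpha>" for i j
  proof -
    let ?k = "\<alpha> ! i + \<alpha> ! j"
    have P: "?P i j \<in> carrier_mat ?k n" and PT: "transpose_mat (?P i j) \<in> carrier_mat n ?k"
      using block_row_pair_carrier by auto
    note XY = X[OF that] Y[OF that]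
    have "transpose_mat (?P i j) * X i j \<in> carrier_mat n ?k"
      and "transpose_mat (?P i j) * Y i j \<in> carrier_mat n ?k"
      using PT XY mult_carrier_mat by blast+
    then show ?thesis
      unfolding t_def ring_mat_simps mult_add_distrib_mat[OF PT XY]
      by (rule add_mult_distrib_mat[OF _ _ P])
  qed
  have inner: "?s (\<lambda>i j. X i j + Y i j) i = ?s X i \<oplus>\<^bsub>?R\<^esub> ?s Y i" for i
  proof -
    have "?s (\<lambda>i j. X i j + Y i j) i = (\<Oplus>\<^bsub>?R\<^esub> j \<in> {i + 1..<length \<alpha>}. t X i j \<oplus>\<^bsub>?R\<^esub> t Y i j)"
      using tX[of i] tY[of i] by (intro R.finsum_cong') (auto simp: dist)
    then show ?thesis
      using R.finsum_addf[OF tX[of i] tY[of i]] by simp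
  qed
  have "(\<Oplus>\<^bsub>?R\<^esub> i \<in> {0..<length \<alpha> - 1}. ?s X i \<oplus>\<^bsub>?R\<^esub> ?s Y i) =
      (\<Oplus>\<^bsub>?R\<^esub> i \<in> {0..<length \<alpha> - 1}. ?s X i) \<oplus>\<^bsub>?R\<^esub> (\<Oplus>\<^bsub>?R\<^esub> i \<in> {0..<length \<alpha> - 1}. ?s Y i)"
    using R.finsum_closed[OF tX] R.finsum_closed[OF tY] by (intro R.finsum_addf) auto
  then have "(\<Oplus>\<^bsub>?R\<^esub> i \<in> {0..<length \<alpha> - 1}. ?s (\<lambda>i j. X i j + Y i j) i) =
      (\<Oplus>\<^bsub>?R\<^esub> i \<in> {0..<length \<alpha> - 1}. ?s X i) + (\<Oplus>\<^bsub>?R\<^esub> i \<in> {0..<length \<alpha> - 1}. ?s Y i)"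
    unfolding inner by (simp only: ring_mat_simps)
  then show ?thesis
    by (simp only: block_fw2_sum_def t_def)
qed

text \<open>All other terms are congruences of zero matrices. These zeros have the size of their
  pair, so that they also qualify as positive semidefinite members of the family.\<close>

lemma block_fw2_sum_single:
  assumes ij: "i < j" "j < length \<alpha>" and Y: "Y \<in> carrier_mat (\<alpha> ! i + \<alpha> ! j) (\<alpha> ! i + \<alpha> ! j)"
  shows "block_fw2_sum n \<alpha> (\<lambda>i' j'. if i' = i \<and> j' = j then Y else 0\<^sub>m (\<alpha> ! i' + \<alpha> ! j') (\<alpha> ! i' + \<alpha> ! j'))
    = transpose_mat (block_row_pair n \<alpha> i j) * Y * block_row_pair n \<alpha> i j"
    (is "block_fw2_sum n \<alpha> ?X = ?T")
proof -
  let ?R = "ring_mat TYPE(real) n ()"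
  interpret R: ring ?R by (rule ring_mat)
  have T: "?T \<in> carrier ?R"
    unfolding ring_mat_simps using Y by (rule congruence_carrier)
  have summand: "transpose_mat (block_row_pair n \<alpha> i' j') * ?X i' j' * block_row_pair n \<alpha> i' j' =
      (if i' = i \<and> j' = j then ?T else \<zero>\<^bsub>?R\<^esub>)" for i' j'
  proof -
    have P: "block_row_pair n \<alpha> i' j' \<in> carrier_mat (\<alpha> ! i' + \<alpha> ! j') n"
      by (rule block_row_pair_carrier)
    then have "transpose_mat (block_row_pair n \<alpha> i' j') * 0\<^sub>m (\<alpha> ! i' + \<alpha> ! j') (\<alpha> ! i' + \<alpha> ! j')
        * block_row_pair n \<alpha> i' j' = 0\<^sub>m n n"
      by (simp add: right_mult_zero_mat[where n=n] left_mult_zero_mat[OF P])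
    then show ?thesis by (simp add: ring_mat_simps)
  qed
  have inner: "(\<Oplus>\<^bsub>?R\<^esub> j' \<in> {i' + 1..<length \<alpha>}. if i' = i \<and> j' = j then ?T else \<zero>\<^bsub>?R\<^esub>) =
      (if i = i' then ?T else \<zero>\<^bsub>?R\<^esub>)" for i'
  proof (cases "i' = i")
    case True
    then show ?thesis
      using R.finsum_singleton[of j "{i + 1..<length \<alpha>}" "\<lambda>_. ?T"] ij T by (simp add: eq_commute[of _ j])
  qed auto
  \<comment> \<open>From \<open>i < j\<close> and \<open>j < length \<alpha>\<close> the index
    \<open>i\<close> lies in the outer range, which stops before
    \<open>length \<alpha> - 1\<close>.\<close>
  show ?thesis
    unfolding block_fw2_sum_def summand inner
    using R.finsum_singleton[of i "{0..<length \<alpha> - 1}" "\<lambda>_. ?T"] ij T by simp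
qed

lemma block_fw2_add:
  assumes "Z \<in> block_fw2 n \<alpha>" and "W \<in> block_fw2 n \<alpha>"
  shows "Z + W \<in> block_fw2 n \<alpha>"
proof -
  obtain X where X: "\<And>i j. i < j \<Longrightarrow> j < length \<alpha> \<Longrightarrow> X i j \<in> psd_mats (\<alpha> ! i + \<alpha> ! j)"
    and Z: "Z \<in> sym_mats n" "Z = block_fw2_sum n \<alpha> X"
    using assms(1) by (auto simp: block_fw2_alt)
  obtain Y where Y: "\<And>i j. i < j \<Longrightarrow> j < length \<alpha> \<Longrightarrow> Y i j \<in> psd_mats (\<alpha> ! i + \<alpha> ! j)"
    and W: "W \<in> sym_mats n" "W = block_fw2_sum n \<alpha> Y"
    using assms(2) by (auto simp: block_fw2_alt)
  have "Z + W = block_fw2_sum n \<alpha> (\<lambda>i j. X i j + Y i j)"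
    unfolding Z W by (rule block_fw2_sum_add[symmetric]) (auto intro: psd_mats_carrier X Y)
  moreover have "Z + W \<in> sym_mats n"
    using Z(1) W(1) by (auto simp: sym_mats_def transpose_add[where nr=n and nc=n])
  ultimately show ?thesis
    unfolding block_fw2_alt using X Y
    by (auto intro!: exI[of _ "\<lambda>i j. X i j + Y i j"] psd_mats_add)
qed

text \<open>With \<open>W = ?P * U\<close>, restoring rows gives
  \<open>U = transpose_mat ?P * W\<close>, so the Gram matrix of \<open>U\<close> is the congruence
  by \<open>?P\<close> of the Gram matrix of \<open>W\<close>.\<close>

lemma gram_in_block_fw2:
  assumes part: "is_partition n \<alpha>" and ij: "i < j" "j < length \<alpha>" and U: "U \<in> carrier_mat n m"
    and supp: "\<And>a c. a < n \<Longrightarrow> c < m \<Longrightarrow> U $$ (a, c) \<noteq> 0 \<Longrightarrow> block_of \<alpha> a = i \<or> block_of \<alpha> a = j"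
  shows "U * transpose_mat U \<in> block_fw2 n \<alpha>"
proof -
  let ?P = "block_row_pair n \<alpha> i j" and ?k = "\<alpha> ! i + \<alpha> ! j"
  define W where "W = ?P * U"
  have P: "?P \<in> carrier_mat ?k n" by (rule block_row_pair_carrier)
  then have W: "W \<in> carrier_mat ?k m" using U by (simp add: W_def)
  have PW: "transpose_mat ?P * W = U"
    unfolding W_def by (rule block_row_pair_restore[OF part ij U supp])
  have "transpose_mat U = transpose_mat W * ?P"
    unfolding PW[symmetric] using transpose_mult[of "transpose_mat ?P" n ?k W m] P W by simp
  then have "U * transpose_mat U = (transpose_mat ?P * W) * (transpose_mat W * ?P)"
    by (simp add: PW)
  also have "\<dots> = transpose_mat ?P * (W * transpose_mat W) * ?P"
    using P W by (simp add: assoc_mult_mat[of _ n ?k _ m _ n] assoc_mult_mat[of _ n ?k _ ?k _ n]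
        assoc_mult_mat[of _ ?k m _ ?k _ n])
  also have "\<dots> = block_fw2_sum n \<alpha> (\<lambda>i' j'. if i' = i \<and> j' = j then W * transpose_mat W
      else 0\<^sub>m (\<alpha> ! i' + \<alpha> ! j') (\<alpha> ! i' + \<alpha> ! j'))"
    by (rule block_fw2_sum_single[OF ij, symmetric]) (use W in simp)
  finally have "U * transpose_mat U = \<dots>" .
  moreover have "U * transpose_mat U \<in> sym_mats n"
    using psd_mats_gram[OF U] by (simp add: psd_mats_def)
  ultimately show ?thesis
    unfolding block_fw2_alt using psd_mats_gram[OF W] psd_mats_zero
    by (auto intro!: exI[of _ "\<lambda>i' j'. if i' = i \<and> j' = j then W * transpose_mat W
      else 0\<^sub>m (\<alpha> ! i' + \<alpha> ! j') (\<alpha> ! i' + \<alpha> ! j')"])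
qed

lemma rank_one_in_block_fw2:
  assumes part: "is_partition n \<alpha>" and ij: "i < length \<alpha>" "j < length \<alpha>" "i \<noteq> j" and d: "0 < d"
    and supp: "\<And>a. a < n \<Longrightarrow> x a \<noteq> 0 \<Longrightarrow> block_of \<alpha> a = i \<or> block_of \<alpha> a = j"
  shows "mat n n (\<lambda>(a, b). x a * x b / d) \<in> block_fw2 n \<alpha>"
proof -
  define U where "U = mat n 1 (\<lambda>(a, c). x a / sqrt d)"
  have U: "U \<in> carrier_mat n 1" by (simp add: U_def)
  have "U * transpose_mat U \<in> block_fw2 n \<alpha>"
  \<comment> \<open>The cone only uses pairs in increasing order, whereas here either block may come
    first.\<close>
  proof (cases "i < j")
    case True
    then show ?thesis
      using ij supp by (intro gram_in_block_fw2[OF part _ _ U]) (auto simp: U_def)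
  next
    case False
    then show ?thesis
      using ij supp by (intro gram_in_block_fw2[OF part _ _ U, of j i]) (auto simp: U_def)
  qed
  moreover have "U * transpose_mat U = mat n n (\<lambda>(a, b). x a * x b / d)"
    using d by (intro eq_matI) (auto simp: U_def scalar_prod_def)
  ultimately show ?thesis by simp
qed

section \<open>Elimination along a forest of blocks\<close>

text \<open>Induction on the size of a set \<open>T\<close> of scalar indices that supports
  \<open>X\<close>. The condition \<open>leaf\<close> is applied to the blocks that meet
  \<open>T\<close>, so a block may be a leaf only after others have been eliminated.\<close>

lemma forest_psd_in_block_fw2:
  assumes part: "is_partition n \<alpha>" and two: "2 \<le> length \<alpha>"
    and leaf: "\<And>S. finite S \<Longrightarrow> S \<noteq> {} \<Longrightarrow> \<exists>v \<in> S. \<exists>w. \<forall>u \<in> S. (v, u) \<in> E \<longrightarrow> u = w"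
    and E: "\<And>u v. (u, v) \<in> E \<Longrightarrow> (v, u) \<in> E"
    and X: "X \<in> psd_mats n"
    and sparse: "\<And>a b. a < n \<Longrightarrow> b < n \<Longrightarrow> X $$ (a, b) \<noteq> 0 \<Longrightarrow>
      block_of \<alpha> a = block_of \<alpha> b \<or> (block_of \<alpha> a, block_of \<alpha> b) \<in> E"
    and supp: "T \<subseteq> {0..<n}" "\<And>a b. a < n \<Longrightarrow> b < n \<Longrightarrow> X $$ (a, b) \<noteq> 0 \<Longrightarrow> a \<in> T \<and> b \<in> T"
  shows "X \<in> block_fw2 n \<alpha>"
  using X sparse supp
proof (induction "card T" arbitrary: T X)
  case 0
  have "T = {}"
    using 0 finite_subset[OF \<open>T \<subseteq> {0..<n}\<close>] by simp
  \<comment> \<open>The zero matrix is written as a rank-one matrix with zero vector, placed on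
    blocks 0 and 1.\<close>
  then have "X = mat n n (\<lambda>(a, b). 0 * 0 / 1)"
    using psd_mats_carrier[OF \<open>X \<in> psd_mats n\<close>] 0(5) by (intro eq_matI) auto
  moreover have "0 < length \<alpha>" "1 < length \<alpha>" using two by auto
  ultimately show ?case
    using rank_one_in_block_fw2[OF part, of 0 1 1 "\<lambda>_. 0"] by simp
next
  case (Suc m)
  have XC: "X \<in> carrier_mat n n" using Suc(3) by (rule psd_mats_carrier)
  have fin: "finite T" using Suc(5) finite_subset by blast
  have "T \<noteq> {}" using Suc(2) by auto
  then obtain v w where v: "v \<in> block_of \<alpha> ` T"
    and w: "\<And>u. u \<in> block_of \<alpha> ` T \<Longrightarrow> (v, u) \<in> E \<Longrightarrow> u = w"
    using leaf[of "block_of \<alpha> ` T"] fin by (metis finite_imageI image_is_empty)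
  then obtain r where r: "r \<in> T" "block_of \<alpha> r = v" by auto
  then have rn: "r < n" using Suc(5) by auto
  have m: "m = card (T - {r})" using Suc(2) r fin by simp
  have sub: "T - {r} \<subseteq> {0..<n}" using Suc(5) by auto
  have vl: "v < length \<alpha>" using block_of(1)[OF part rn] r by simp
  \<comment> \<open>If \<open>v\<close> has no neighbour among the remaining blocks, any other block serves as its partner.\<close>
  define w' where "w' = (if w < length \<alpha> \<and> w \<noteq> v then w else if v = 0 then 1 else 0)"
  have w': "w' < length \<alpha>" "w' \<noteq> v" using two by (auto simp: w'_def)
  \<comment> \<open>Outside \<open>v\<close>, a nonzero entry of column \<open>r\<close> lies in a
    neighbour of \<open>v\<close> that meets \<open>T\<close>, hence in block \<open>w\<close>, and
    then \<open>w' = w\<close>.\<close>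
  have col_supp: "block_of \<alpha> a = w' \<or> block_of \<alpha> a = v" if "a < n" "X $$ (a, r) \<noteq> 0" for a
  proof (rule disjCI)
    assume "block_of \<alpha> a \<noteq> v"
    moreover from this have "(v, block_of \<alpha> a) \<in> E"
      using Suc(4)[OF that(1) rn that(2)] r(2) E by blast
    moreover have "a \<in> T"
      using Suc(6)[OF that(1) rn that(2)] by simp
    ultimately show "block_of \<alpha> a = w'"
      using w[of "block_of \<alpha> a"] block_of(1)[OF part that(1)] by (simp add: w'_def)
  qed
  show ?case
  proof (cases "X $$ (r, r) = 0")
    case True
    have z: "X $$ (a, r) = 0" "X $$ (r, a) = 0" if "a < n" for a
      using psd_zero_diag[OF Suc(3) rn True that] psd_mats_sym[OF Suc(3) rn that] by auto
    show ?thesis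
    proof (rule Suc(1)[OF m Suc(3,4) sub])
      fix a b assume "a < n" "b < n" "X $$ (a, b) \<noteq> 0"
      then show "a \<in> T - {r} \<and> b \<in> T - {r}"
        using Suc(6)[of a b] z by auto
    qed
  next
    case False
    \<comment> \<open>At \<open>v = 0\<close> and \<open>t = 1\<close> the shifted form is just the
      diagonal entry.\<close>
    have "0 \<le> X $$ (r, r)"
      using psd_quadratic_shift[OF Suc(3) rn, of "0\<^sub>v n" 1] XC rn by simp
    then have pos: "0 < X $$ (r, r)" using False by simp
    define S where "S = mat n n (\<lambda>(a, b). X $$ (a, b) - X $$ (a, r) * X $$ (b, r) / X $$ (r, r))"
    define R where "R = mat n n (\<lambda>(a, b). X $$ (a, r) * X $$ (b, r) / X $$ (r, r))"
    have S_index: "S $$ (a, b) = X $$ (a, b) - X $$ (a, r) * X $$ (b, r) / X $$ (r, r)"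
      if "a < n" "b < n" for a b
      using that by (simp add: S_def)
    have fill: "X $$ (a, b) \<noteq> 0 \<or> (X $$ (a, r) \<noteq> 0 \<and> X $$ (b, r) \<noteq> 0)"
      if "a < n" "b < n" "S $$ (a, b) \<noteq> 0" for a b
      using that by (auto simp: S_index)
    have "S \<in> block_fw2 n \<alpha>"
    proof (rule Suc(1)[OF m _ _ sub])
      show "S \<in> psd_mats n"
        unfolding S_def by (rule psd_schur_complement[OF Suc(3) rn pos])
    next
      fix a b assume ab: "a < n" "b < n" "S $$ (a, b) \<noteq> 0"
      \<comment> \<open>Fill-in needs both \<open>a\<close> and \<open>b\<close> in the support of
        column \<open>r\<close>, hence in blocks \<open>v\<close> and \<open>w'\<close>. If their
        blocks differ, the nonzero entry of column \<open>r\<close> in \<open>w'\<close> shows that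
        these two blocks are adjacent.\<close>
      show "block_of \<alpha> a = block_of \<alpha> b \<or> (block_of \<alpha> a, block_of \<alpha> b) \<in> E"
        using fill[OF ab] Suc(4)[OF ab(1,2)] Suc(4)[OF ab(1) rn] Suc(4)[OF ab(2) rn]
          col_supp[OF ab(1)] col_supp[OF ab(2)] r E by metis
      \<comment> \<open>Row and column \<open>r\<close> cancel exactly, so the support shrinks to
        \<open>T - {r}\<close>.\<close>
      have "S $$ (a, r) = 0" "S $$ (r, b) = 0"
        using ab rn pos psd_mats_sym[OF Suc(3) rn ab(2)] by (auto simp: S_index)
      then have "a \<noteq> r" "b \<noteq> r" using ab by auto
      then show "a \<in> T - {r} \<and> b \<in> T - {r}"
        using fill[OF ab] Suc(6)[OF ab(1,2)] Suc(6)[OF ab(1) rn] Suc(6)[OF ab(2) rn] by auto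
    qed
    moreover have "R \<in> block_fw2 n \<alpha>"
      unfolding R_def
      by (rule rank_one_in_block_fw2[OF part w'(1) vl w'(2) pos, where x = "\<lambda>a. X $$ (a, r)"])
        (rule col_supp)
    moreover have "X = S + R"
      using XC by (intro eq_matI) (auto simp: S_def R_def)
    ultimately show ?thesis
      using block_fw2_add by metis
  qed
qed

theorem proposition4:
  fixes n :: nat and \<alpha> :: "nat list" and G :: "nat pair_pre_digraph"
  assumes "is_partition n \<alpha>" and "2 \<le> length \<alpha>"
    and "pair_graph G" and "pverts G = {0..<length \<alpha>}" and "chordal G"
    and "Max (card ` {C. maximal_clique G C}) = 2"
  shows "sparse_block_psd n \<alpha> (parcs G) \<subseteq> block_fw2 n \<alpha>"
proof
  interpret pair_graph G by fact
  fix X assume X: "X \<in> sparse_block_psd n \<alpha> (parcs G)"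
  have sym: "(v, u) \<in> parcs G" if "(u, v) \<in> parcs G" for u v
    using that arcs_symmetric by blast
  have irrefl: "(u, u) \<notin> parcs G" for u
    using no_loops by fastforce
  \<comment> \<open>The maximum over maximal cliques bounds every clique by two vertices, which
    excludes triangles.\<close>
  have acyclic: "\<not> cycle_verts (parcs G) xs" for xs
    using clique_card_le_Max[of G] assms(3-6) by (intro chordal_triangle_free_acyclic) auto
  show "X \<in> block_fw2 n \<alpha>"
  proof (rule forest_psd_in_block_fw2[OF assms(1,2), where E = "parcs G" and T = "{0..<n}"])
    show "\<exists>v \<in> S. \<exists>w. \<forall>u \<in> S. (v, u) \<in> parcs G \<longrightarrow> u = w" if "finite S" "S \<noteq> {}" for S
      by (rule acyclic_ex_leaf[OF that]) (use sym irrefl acyclic in auto)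
    show "X \<in> psd_mats n"
      using X by (simp add: sparse_block_psd_def)
    show "block_of \<alpha> a = block_of \<alpha> b \<or> (block_of \<alpha> a, block_of \<alpha> b) \<in> parcs G"
      if "a < n" "b < n" "X $$ (a, b) \<noteq> 0" for a b
      using sparse_block_psdD[OF assms(1) X that] by blast
  qed (use sym in auto)
qed

end
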